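(* Let $R$ be a ring. The ring of formal power series $R[[x]]$ is a $C\Delta$ ring if and only if $R$ is a $C\Delta$ ring.
   Context: All rings are associative with identity, not necessarily commutative. $U(R)$ is the group of units of $R$ and $C(R)$ its set of central elements. $\Delta(R)=\{a\in R : 1-ua\in U(R)\text{ for all }u\in U(R)\}$. A ring $R$ is called $C\Delta$ if every $a\in R$ can be written as $a=c+r$ with $c\in C(R)$ and $r\in\Delta(R)$. In $R[[x]]$ the variable $x$ commutes with the elements of $R$. *)

theory Defs
  imports "HOL-Computational_Algebra.Formal_Power_Series"
begin

text \<open>
  Associative rings with identity, not necessarily commutative, are the types of sort
  \<open>{ring, monoid_mult}\<close>. The class \<^class>\<open>ring_1\<close> would additionally
  require \<open>0 \<noteq> 1\<close> and so exclude the zero ring. For the same reason, the library's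
  instance of \<^class>\<open>monoid_mult\<close> for \<^type>\<open>fps\<close>, which assumes
  \<^class>\<open>semiring_1\<close>, is generalised here. The multiplication of
  \<^type>\<open>fps\<close> is the Cauchy product, so the variable commutes with the coefficients
  (\<open>fps_mult_fps_X_commute\<close>).
\<close>

instance fps :: ("{semiring_0, monoid_mult}") monoid_mult
  by standard (simp_all add: fps_one_mult)

text \<open>Units are two-sided; \<open>u dvd 1\<close> would only express right invertibility.\<close>

definition ring_units :: "'a::{ring, monoid_mult} set" where
  "ring_units = {u. \<exists>v. u * v = 1 \<and> v * u = 1}"

definition ring_center :: "'a::{ring, monoid_mult} set" where
  "ring_center = {c. \<forall>a. c * a = a * c}"

definition ring_Delta :: "'a::{ring, monoid_mult} set" where
  "ring_Delta = {a. \<forall>u \<in> ring_units. 1 - u * a \<in> ring_units}"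

definition CDelta_ring :: "'a::{ring, monoid_mult} itself \<Rightarrow> bool" where
  "CDelta_ring _ \<longleftrightarrow>
    (\<forall>a::'a. \<exists>c \<in> ring_center. \<exists>r \<in> ring_Delta. a = c + r)"

end

theory Submission
  imports Defs
begin

unbundle fps_syntax

text \<open>
  A power series is a unit iff its constant coefficient is, so it lies in \<open>\<Delta>(R[[x]])\<close> iff
  its constant coefficient lies in \<open>\<Delta>(R)\<close>. A decomposition of \<open>f $ 0\<close> in \<open>R\<close> therefore lifts
  to one of \<open>f\<close> with central part a constant series, and a decomposition of a constant series
  restricts to one in \<open>R\<close> by taking constant coefficients.
\<close>

text \<open>
  The library's \<open>fps_left_inverse\<close> and \<open>fps_right_inverse\<close> lemmas assume \<^class>\<open>ring_1\<close>,
  which excludes the zero ring.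
\<close>

lemma fps_left_inverse_mult:
  fixes f :: "'a::{ring, monoid_mult} fps"
  assumes "x * f $ 0 = 1"
  shows "fps_left_inverse f x * f = 1"
proof (rule fps_ext)
  fix n show "(fps_left_inverse f x * f) $ n = 1 $ n"
    \<comment> \<open>At \<open>Suc m\<close> the last summand cancels the rest: the recursion sets
      that coefficient to minus their sum times \<open>x\<close>, and
      \<open>x * f $ 0 = 1\<close>.\<close>
    by (cases n) (simp_all add: assms fps_mult_nth mult.assoc)
qed

lemma fps_right_inverse_mult:
  fixes f :: "'a::{ring, monoid_mult} fps"
  assumes "f $ 0 * y = 1"
  shows "f * fps_right_inverse f y = 1"
proof (rule fps_ext)
  fix n show "(f * fps_right_inverse f y) $ n = 1 $ n"
    \<comment> \<open>Here the cancelling summand is the first one, so it is split off.\<close>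
    by (cases n)
      (simp_all add: assms fps_mult_nth sum.atLeast_Suc_atMost flip: mult.assoc)
qed

text \<open>Lets the left and right inverse series come from different recursions: associativity
  forces them to agree.\<close>

lemma ring_unitsI:
  assumes "v * u = 1" and "u * w = 1"
  shows "u \<in> ring_units"
proof -
  have "v = v * (u * w)"
    by (simp add: assms(2))
  also have "\<dots> = w"
    by (simp add: assms(1) flip: mult.assoc)
  finally show ?thesis
    using assms by (auto simp: ring_units_def)
qed

lemma fps_ring_units_iff:
  fixes f :: "'a::{ring, monoid_mult} fps"
  shows "f \<in> ring_units \<longleftrightarrow> f $ 0 \<in> ring_units"
proof
  assume "f \<in> ring_units"
  then obtain g where "f * g = 1" "g * f = 1"
    by (auto simp: ring_units_def)
  then have "f $ 0 * g $ 0 = 1" "g $ 0 * f $ 0 = 1"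
    by (simp_all flip: fps_mult_nth_0)
  then show "f $ 0 \<in> ring_units"
    by (auto simp: ring_units_def)
next
  assume "f $ 0 \<in> ring_units"
  then obtain v where "f $ 0 * v = 1" "v * f $ 0 = 1"
    by (auto simp: ring_units_def)
  then show "f \<in> ring_units"
    by (blast intro: ring_unitsI fps_left_inverse_mult fps_right_inverse_mult)
qed

lemma fps_ring_Delta_iff:
  fixes f :: "'a::{ring, monoid_mult} fps"
  shows "f \<in> ring_Delta \<longleftrightarrow> f $ 0 \<in> ring_Delta"
proof
  assume f: "f \<in> ring_Delta"
  have "1 - u * f $ 0 \<in> ring_units" if "u \<in> ring_units" for u
  proof -
    have "fps_const u \<in> ring_units"
      using that by (simp add: fps_ring_units_iff)
    then have "1 - fps_const u * f \<in> ring_units"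
      using f by (simp add: ring_Delta_def)
    then show ?thesis
      by (simp add: fps_ring_units_iff)
  qed
  then show "f $ 0 \<in> ring_Delta"
    by (simp add: ring_Delta_def)
\<comment> \<open>Conversely, \<open>1 - u * f\<close> has constant coefficient
  \<open>1 - u $ 0 * f $ 0\<close>, and \<open>u $ 0\<close> is a unit.\<close>
qed (simp add: ring_Delta_def fps_ring_units_iff)

lemma fps_const_in_ring_center:
  "c \<in> ring_center \<Longrightarrow> fps_const c \<in> ring_center"
  by (simp add: ring_center_def fps_eq_iff)

lemma fps_nth_0_in_ring_center:
  assumes "c \<in> ring_center"
  shows "c $ 0 \<in> ring_center"
proof -
  have "c $ 0 * a = a * c $ 0" for a
  proof -
    have "c * fps_const a = fps_const a * c"
      using assms by (simp add: ring_center_def)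
    from arg_cong[OF this, of "\<lambda>f. f $ 0"] show ?thesis
      by simp
  qed
  then show ?thesis
    by (simp add: ring_center_def)
qed

theorem corollary3p7:
  shows "CDelta_ring TYPE('a::{ring, monoid_mult} fps) \<longleftrightarrow> CDelta_ring TYPE('a)"
proof
  assume fps: "CDelta_ring TYPE('a fps)"
  show "CDelta_ring TYPE('a)"
    unfolding CDelta_ring_def
  proof
    fix a :: 'a
    obtain c r :: "'a fps"
      where cr: "c \<in> ring_center" "r \<in> ring_Delta" "fps_const a = c + r"
      using fps unfolding CDelta_ring_def by blast
    have "a = c $ 0 + r $ 0"
      using arg_cong[OF cr(3), of "\<lambda>f. f $ 0"] by simp
    with cr(1,2) show "\<exists>c\<in>ring_center. \<exists>r\<in>ring_Delta. a = c + r"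
      using fps_nth_0_in_ring_center fps_ring_Delta_iff by blast
  qed
next
  assume base: "CDelta_ring TYPE('a)"
  show "CDelta_ring TYPE('a fps)"
    unfolding CDelta_ring_def
  proof
    fix f :: "'a fps"
    obtain c r where cr: "c \<in> ring_center" "r \<in> ring_Delta" "f $ 0 = c + r"
      using base unfolding CDelta_ring_def by blast
    \<comment> \<open>Its constant coefficient is \<open>r\<close>.\<close>
    have "f - fps_const c \<in> ring_Delta"
      using cr by (simp add: fps_ring_Delta_iff)
    moreover have "f = fps_const c + (f - fps_const c)"
      by simp
    ultimately show "\<exists>c\<in>ring_center. \<exists>r\<in>ring_Delta. f = c + r"
      using cr(1) fps_const_in_ring_center by blast
  qed
qed

end
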